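(* Let $a<b$ be real numbers, $D\subseteq[a,b]$, $D^+=(-\infty,b]$, $n\ge1$ and $\alpha\in(0,0.5]$. Let $\boldsymbol{\ell}=\mathbf{u}^{\text{And}}$ and let $T(\mathbf{y})=b^{\alpha,\text{Anderson}}_{\boldsymbol{\ell}}(\mathbf{y})=m_{D^+}(\mathbf{y},\mathbf{u}^{\text{And}})$. Then for every $\mathbf{x}\in D^n$, $$b^{\alpha}_{D^+,T}(\mathbf{x})\le b^{\alpha,\text{Hoeffding}}(\mathbf{x}),$$ and the inequality is strict when $n\ge3$.
   Context: For a vector $\mathbf{v}\in\mathbb{R}^n$ let $v_{(1)}\le\dots\le v_{(n)}$ denote its sorted entries. Let $E\subset\mathbb{R}$ with $s_E=\sup E<\infty$ (here $E=D^+$). For $\mathbf{x}\in E^n$ and $\boldsymbol{\ell}\in[0,1]^n$, with the conventions $\ell_{(0)}=0$, $\ell_{(n+1)}=1$, $x_{(n+1)}=s_E$, put $$m_E(\mathbf{x},\boldsymbol{\ell})=\sum_{i=1}^{n+1}x_{(i)}(\ell_{(i)}-\ell_{(i-1)})=s_E-\sum_{i=1}^n \ell_{(i)}(x_{(i+1)}-x_{(i)}).$$ For $T:E^n\to\mathbb{R}$ and $\mathbf{x}\in E^n$ let $\mathbb{S}_{E,T}(\mathbf{x})=\{\mathbf{y}\in E^n:T(\mathbf{y})\le T(\mathbf{x})\}$ and $b_{E,T}(\mathbf{x},\mathbf{u})=\sup_{\mathbf{z}\in\mathbb{S}_{E,T}(\mathbf{x})}m_E(\mathbf{z},\mathbf{u})$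 for $\mathbf{u}\in[0,1]^n$. Let $\mathbf{U}=(U_1,\dots,U_n)$ have i.i.d. uniform$[0,1]$ entries. With $Q(p,Y)=\inf\{y\in\mathbb{R}:F_Y(y)\ge p\}$ the quantile function of a random variable $Y$ with CDF $F_Y$, define $b^{\alpha}_{E,T}(\mathbf{x})=Q(1-\alpha,b_{E,T}(\mathbf{x},\mathbf{U}))$. The vector $\mathbf{u}^{\text{And}}\in[0,1]^n$ is $u^{\text{And}}_i=\max\{0,\,i/n-\beta(n)\}$, where $\beta(n)$ (depending on $n$ and $\alpha$) is the number such that $\mathbb{P}_{\mathbf{U}}(\forall i\in\{1,\dots,n\},\ U_{(i)}\ge i/n-\beta(n))=1-\alpha$ (one-sided Kolmogorov–Smirnov quantile). Hoeffding's bound is $b^{\alpha,\text{Hoeffding}}(\mathbf{x})=\frac1n\sum_{i=1}^n x_i+(b-a)\sqrt{\frac{\ln(1/\alpha)}{2n}}$. *)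

theory Defs
  imports "HOL-Probability.Probability"
begin

text \<open>A vector in \<open>E\<^sup>n\<close> is an element of \<open>{1..n} \<rightarrow>\<^sub>E E\<close>.\<close>

definition order_stat :: "nat \<Rightarrow> (nat \<Rightarrow> real) \<Rightarrow> nat \<Rightarrow> real"
  where "order_stat n v i = sort (map v [1..<n + 1]) ! (i - 1)"

text \<open>The updates put in the conventions for the indices \<open>0\<close> and \<open>n + 1\<close>, at which
  \<^const>\<open>order_stat\<close> itself is meaningless.\<close>

definition m_fun :: "nat \<Rightarrow> real set \<Rightarrow> (nat \<Rightarrow> real) \<Rightarrow> (nat \<Rightarrow> real) \<Rightarrow> real"
  where "m_fun n E x l =
    (let X = (order_stat n x)(n + 1 := Sup E);
         L = (order_stat n l)(0 := 0, n + 1 := 1)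
     in \<Sum>i = 1..n + 1. X i * (L i - L (i - 1)))"

lemma m_fun_alt:
  "m_fun n E x l =
    (let X = (order_stat n x)(n + 1 := Sup E)
     in Sup E - (\<Sum>i = 1..n. order_stat n l i * (X (i + 1) - X i)))"
proof -
  have parts: "(\<Sum>i = 1..k + 1. X i * (L i - L (i - 1))) =
      X (k + 1) * L (k + 1) - X 1 * L 0 - (\<Sum>i = 1..k. L i * (X (i + 1) - X i))"
    for X L :: "nat \<Rightarrow> real" and k
    by (induction k) (simp_all add: algebra_simps)
  define L where "L = (order_stat n l)(0 := 0, n + 1 := 1)"
  have "L 0 = 0" "L (n + 1) = 1" "\<And>i. i \<in> {1..n} \<Longrightarrow> L i = order_stat n l i"
    by (auto simp: L_def)
  then show ?thesis
    unfolding m_fun_def Let_def L_def [symmetric] parts by simp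
qed

definition S_set :: "nat \<Rightarrow> real set \<Rightarrow> ((nat \<Rightarrow> real) \<Rightarrow> real) \<Rightarrow> (nat \<Rightarrow> real) \<Rightarrow> (nat \<Rightarrow> real) set"
  where "S_set n E T x = {y \<in> {1..n} \<rightarrow>\<^sub>E E. T y \<le> T x}"

definition b_fun :: "nat \<Rightarrow> real set \<Rightarrow> ((nat \<Rightarrow> real) \<Rightarrow> real) \<Rightarrow> (nat \<Rightarrow> real) \<Rightarrow> (nat \<Rightarrow> real) \<Rightarrow> real"
  where "b_fun n E T x u = (SUP z \<in> S_set n E T x. m_fun n E z u)"

text \<open>The law of \<open>n\<close> independent uniform variables on \<open>[0, 1]\<close>. Restricting \<^const>\<open>lborel\<close>, rather
  than using \<^const>\<open>uniform_measure\<close>, makes the underlying space exactly \<open>[0, 1]\<^sup>n\<close>, where the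
  supremum in \<^const>\<open>b_fun\<close> is finite.\<close>

definition unif_cube :: "nat \<Rightarrow> (nat \<Rightarrow> real) measure"
  where "unif_cube n = (\<Pi>\<^sub>M i\<in>{1..n}. restrict_space lborel {0..1})"

definition quantile :: "'a measure \<Rightarrow> real \<Rightarrow> ('a \<Rightarrow> real) \<Rightarrow> real"
  where "quantile M p Y = Inf {y. cdf (distr M borel Y) y \<ge> p}"

definition b_bound :: "nat \<Rightarrow> real \<Rightarrow> real set \<Rightarrow> ((nat \<Rightarrow> real) \<Rightarrow> real) \<Rightarrow> (nat \<Rightarrow> real) \<Rightarrow> real"
  where "b_bound n \<alpha> E T x = quantile (unif_cube n) (1 - \<alpha>) (b_fun n E T x)"

definition beta_KS :: "nat \<Rightarrow> real \<Rightarrow> real"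
  where "beta_KS n \<alpha> =
    (THE \<beta>. measure (unif_cube n)
       {u \<in> space (unif_cube n). \<forall>i\<in>{1..n}. order_stat n u i \<ge> real i / real n - \<beta>} = 1 - \<alpha>)"

definition u_And :: "nat \<Rightarrow> real \<Rightarrow> nat \<Rightarrow> real"
  where "u_And n \<alpha> = (\<lambda>i\<in>{1..n}. max 0 (real i / real n - beta_KS n \<alpha>))"

definition anderson_bound :: "nat \<Rightarrow> real set \<Rightarrow> (nat \<Rightarrow> real) \<Rightarrow> (nat \<Rightarrow> real) \<Rightarrow> real"
  where "anderson_bound n E l y = m_fun n E y l"

definition hoeffding_bound :: "nat \<Rightarrow> real \<Rightarrow> real \<Rightarrow> real \<Rightarrow> (nat \<Rightarrow> real) \<Rightarrow> real"
  where "hoeffding_bound n \<alpha> a b x =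
    (\<Sum>i = 1..n. x i) / real n + (b - a) * sqrt (ln (1 / \<alpha>) / (2 * real n))"

end

theory Submission imports Defs begin

text \<open>If the uniform sample satisfies \<open>U\<^sub>(\<^sub>i\<^sub>) \<ge> i/n - \<beta>\<close> for all \<open>i\<close>, which has probability
  \<open>1 - \<alpha>\<close>, then \<open>m(z, U) \<le> m(z, u_And) \<le> m(x, u_And)\<close> for all \<open>z\<close> in the sublevel set, so the
  quantile is at most the Anderson bound, and the latter is at most \<open>mean x + \<beta> (b - a)\<close> by
  summation by parts. Hence everything reduces to \<open>\<beta> < \<epsilon> = sqrt (ln (1/\<alpha>) / (2n))\<close>, the one-sided
  Dvoretzky--Kiefer--Wolfowitz--Massart inequality
  \<open>P(\<exists>i. U\<^sub>(\<^sub>i\<^sub>) < i/n - \<epsilon>) < exp (- 2 n \<epsilon>\<^sup>2)\<close> in a strict form.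

  For the latter, split the event according to the last \<open>i\<close> for which it occurs; for that \<open>i\<close> exactly
  \<open>i\<close> sample points lie below \<open>t = i/n - \<epsilon>\<close>. Now move mass \<open>\<delta>\<close> of the uniform law close to \<open>0\<close>.
  This multiplies the probability of the \<open>i\<close>-th piece by
  \<open>(1 - \<delta> + \<delta>/t)\<^sup>i (1 - \<delta>)\<^sup>n\<^sup>-\<^sup>i\<close>, and a choice of \<open>\<delta>\<close> depending on \<open>\<epsilon>\<close> only makes this factor
  exceed \<open>exp (2 n \<epsilon>\<^sup>2)\<close> for every \<open>i\<close>. The new probabilities add up to at most \<open>1\<close>.\<close>

subsection \<open>The exponent of the change of measure\<close>

text \<open>The mass \<open>\<delta>\<close> as a function of \<open>\<epsilon>\<close>. The slope \<open>2\<close> at \<open>0\<close> is forced: it makes \<open>1/n\<close> times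
  the logarithm of the factor above agree with \<open>2 \<epsilon>\<^sup>2\<close> to first order. The higher coefficients are chosen such that
  the difference of the two is convex in \<open>\<epsilon>\<close>, whatever \<open>t\<close> is.\<close>

definition tilt :: "real \<Rightarrow> real"
  where "tilt e = 2 * e - 4 / 3 * e ^ 2 + e ^ 3 / 3"

text \<open>These bounds make \<open>tilt e\<close> a valid mixture weight and keep the logarithm of
  \<open>1 - tilt e\<close> defined.\<close>

lemma tilt_bounds:
  assumes "0 \<le> e" "e < 1"
  shows "0 \<le> tilt e" "tilt e < 1"
proof -
  have "1 - tilt e = (1 - e) * ((1 - e) + e ^ 2 / 3)"
    unfolding tilt_def by algebra
  moreover have "0 < (1 - e) * ((1 - e) + e ^ 2 / 3)"
    using assms by (intro mult_pos_pos add_pos_nonneg) auto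
  ultimately show "tilt e < 1"
    by simp
  have "tilt e = e * (2 * (1 - e) + 2 / 3 * e + e ^ 2 / 3)"
    unfolding tilt_def by algebra
  also have "0 \<le> e * (2 * (1 - e) + 2 / 3 * e + e ^ 2 / 3)"
    using assms by (intro mult_nonneg_nonneg add_nonneg_nonneg) auto
  finally show "0 \<le> tilt e" .
qed

text \<open>As a polynomial in \<open>r\<close> the expression is a quadratic, expanded below around
  \<open>r = 1 + 7 / 3 * e\<close>; the three coefficients are given in the Bernstein basis of \<open>[0, 1]\<close>.\<close>

lemma curvature_numerator_pos:
  fixes e r :: real
  assumes "0 < e" "e < 1" "0 < r"
  defines "d \<equiv> tilt e" and "d' \<equiv> 2 - 8 / 3 * e + e ^ 2" and "d'' \<equiv> 2 * e - 8 / 3"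
  shows "0 < (2 * d' * (1 + r) + e * d'' * (1 + r) - d'' * r * d) * (1 - d) * (1 + d * r)
    - d' ^ 2 * r * (1 + d ^ 2 * r) + d' ^ 2 * e * (1 + r) * (1 - r + 2 * d * r)
    - 4 * (1 - d) ^ 2 * (1 + d * r) ^ 2" (is "0 < ?Q")
proof -
  define w where "w = 1 - e"
  define A where "A = 324 * w ^ 11 + 972 * e * w ^ 10 + 1188 * e ^ 2 * w ^ 9
    + 1068 * e ^ 3 * w ^ 8 + 1515 * e ^ 4 * w ^ 7 + 2185 * e ^ 5 * w ^ 6 + 2045 * e ^ 6 * w ^ 5
    + 1193 * e ^ 7 * w ^ 4 + 433 * e ^ 8 * w ^ 3 + 92 * e ^ 9 * w ^ 2 + 9 * e ^ 10 * w"
  define B where "B = 4860 * w ^ 11 + 3780 * e * w ^ 10 + 36675 * e ^ 2 * w ^ 9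
    + 228885 * e ^ 3 * w ^ 8 + 546990 * e ^ 4 * w ^ 7 + 716620 * e ^ 5 * w ^ 6
    + 587150 * e ^ 6 * w ^ 5 + 316340 * e ^ 7 * w ^ 4 + 112480 * e ^ 8 * w ^ 3
    + 25220 * e ^ 9 * w ^ 2 + 3105 * e ^ 10 * w + 135 * e ^ 11"
  define C where "C = 972 * w ^ 12 + 32076 * e * w ^ 11 + 192564 * e ^ 2 * w ^ 10
    + 500814 * e ^ 3 * w ^ 9 + 722964 * e ^ 4 * w ^ 8 + 636327 * e ^ 5 * w ^ 7
    + 349523 * e ^ 6 * w ^ 6 + 115465 * e ^ 7 * w ^ 5 + 20266 * e ^ 8 * w ^ 4
    + 1967 * e ^ 9 * w ^ 3 + 952 * e ^ 10 * w ^ 2 + 477 * e ^ 11 * w + 81 * e ^ 12"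
  have "0 < w"
    using assms by (simp add: w_def)
  have "0 \<le> A" "0 \<le> B" "0 < C"
    using \<open>0 < e\<close> \<open>0 < w\<close> unfolding A_def B_def C_def
    by (intro add_nonneg_nonneg add_pos_pos mult_nonneg_nonneg mult_pos_pos; simp)+
  \<comment> \<open>Three times \<open>d\<close>, \<open>d'\<close> and \<open>d''\<close>, so that
    the identity left to \<open>algebra\<close> has integer coefficients.\<close>
  define d3 p q where "d3 = 6 * e - 4 * e ^ 2 + e ^ 3" and "p = 6 - 8 * e + 3 * e ^ 2" and "q = 6 * e - 8"
  have d: "d = d3 / 3" "d' = p / 3" "d'' = q / 3"
    by (auto simp: d3_def p_def q_def d_def d'_def d''_def tilt_def field_simps)
  have "81 * ?Q = (3 * (2 * p + e * q) * (1 + r) - q * r * d3) * (3 - d3) * (3 + d3 * r)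
      - p ^ 2 * r * (9 + d3 ^ 2 * r) + 3 * p ^ 2 * e * (1 + r) * (3 - 3 * r + 2 * d3 * r)
      - 4 * (3 - d3) ^ 2 * (3 + d3 * r) ^ 2"
    unfolding d by (simp add: field_simps power2_eq_square)
  moreover have "45 * ((3 * (2 * p + e * q) * (1 + r) - q * r * d3) * (3 - d3) * (3 + d3 * r)
      - p ^ 2 * r * (9 + d3 ^ 2 * r) + 3 * p ^ 2 * e * (1 + r) * (3 - 3 * r + 2 * d3 * r)
      - 4 * (3 - d3) ^ 2 * (3 + d3 * r) ^ 2)
    = e * (5 * A * (3 * r - 3 - 7 * e) ^ 2 + e * (3 * B * r + 5 * C))" (is "45 * ?R = _")
    unfolding A_def B_def C_def w_def d3_def p_def q_def by algebra
  moreover have "0 < e * (5 * A * (3 * r - 3 - 7 * e) ^ 2 + e * (3 * B * r + 5 * C))"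
    using \<open>0 \<le> A\<close> \<open>0 \<le> B\<close> \<open>0 < C\<close> \<open>0 < e\<close> \<open>0 < r\<close>
    by (intro mult_pos_pos add_nonneg_pos mult_nonneg_nonneg) auto
  moreover have "0 < Q" if "81 * Q = R" "45 * R = Z" "0 < Z" for Q R Z :: real
    using that by linarith
  ultimately show ?thesis
    by blast
qed

text \<open>With \<open>t + e = i/n\<close>, the right-hand side is \<open>1/n\<close> times the
  logarithm of the factor by which the change of measure multiplies the \<open>i\<close>-th piece.
  For fixed \<open>t\<close>, the difference \<open>G\<close> of the two sides vanishes at
  \<open>0\<close> together with its derivative, and its second derivative is positive on
  \<open>(0, 1)\<close>.\<close>

lemma tilt_exponent:
  assumes "0 < e" "e < 1" "0 < t" "t + e \<le> 1"
  shows "2 * e ^ 2 < (1 - t - e) * ln (1 - tilt e) + (t + e) * ln (1 + tilt e * ((1 - t) / t))"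
proof -
  define r where "r = (1 - t) / t"
  have "0 < r" and t: "t * (1 + r) = 1"
    using assms by (auto simp: r_def field_simps)
  define d' where "d' z = 2 - 8 / 3 * z + z ^ 2" for z :: real
  define d'' where "d'' z = 2 * z - 8 / 3" for z :: real
  \<comment> \<open>Naming the reciprocals makes the derivatives polynomial, so that
    \<open>algebra\<close> can bring \<open>G''\<close> over a common denominator from
    \<open>i z * (1 - tilt z) = 1\<close>, \<open>j z * (1 + tilt z * r) = 1\<close> and
    \<open>t * (1 + r) = 1\<close>.\<close>
  define i where "i z = 1 / (1 - tilt z)" for z
  define j where "j z = 1 / (1 + tilt z * r)" for z
  define K where "K z = ln (1 - tilt z)" for z
  define L where "L z = ln (1 + tilt z * r)" for z
  define G where "G z = (1 - t - z) * K z + (t + z) * L z - 2 * z ^ 2" for z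
  define G' where "G' z = - K z - (1 - t - z) * (d' z * i z)
    + L z + (t + z) * (d' z * r * j z) - 4 * z" for z
  define G'' where "G'' z = ((2 * d' z * (1 + r) + z * d'' z * (1 + r) - d'' z * r * tilt z)
      * (1 - tilt z) * (1 + tilt z * r)
    - d' z ^ 2 * r * (1 + tilt z ^ 2 * r) + d' z ^ 2 * z * (1 + r) * (1 - r + 2 * tilt z * r)
    - 4 * (1 - tilt z) ^ 2 * (1 + tilt z * r) ^ 2) * (i z ^ 2 * j z ^ 2)" for z
  have pos: "0 < 1 - tilt z" "0 < 1 + tilt z * r" if "0 \<le> z" "z < 1" for z
    using tilt_bounds[OF that] \<open>0 < r\<close> by (auto intro!: add_pos_nonneg)
  have ij: "i z * (1 - tilt z) = 1" "j z * (1 + tilt z * r) = 1" "0 < i z" "0 < j z"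
    if "0 \<le> z" "z < 1" for z
    using pos[OF that] by (auto simp: i_def j_def)
  have tilt': "(tilt has_real_derivative d' z) (at z)" for z
    unfolding tilt_def d'_def by (auto intro!: derivative_eq_intros)
  have d'': "(d' has_real_derivative d'' z) (at z)" for z
    unfolding d'_def d''_def by (auto intro!: derivative_eq_intros)
  have u: "((\<lambda>z. 1 - tilt z) has_real_derivative - d' z) (at z)"
    and v: "((\<lambda>z. 1 + tilt z * r) has_real_derivative d' z * r) (at z)" for z
    by (auto intro!: derivative_eq_intros tilt')
  have ln1: "(K has_real_derivative - d' z * i z) (at z)" if "0 \<le> z" "z < 1" for z
    using DERIV_chain2[OF DERIV_ln_divide u, OF pos(1)[OF that]] by (simp add: K_def[abs_def] i_def)
  have ln2: "(L has_real_derivative d' z * r * j z) (at z)"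
    if "0 \<le> z" "z < 1" for z
    using DERIV_chain2[OF DERIV_ln_divide v, OF pos(2)[OF that]] by (simp add: L_def[abs_def] j_def)
  have i': "(i has_real_derivative d' z * i z ^ 2) (at z)" if "0 \<le> z" "z < 1" for z
    using DERIV_inverse_fun[OF u[of z]] pos(1)[OF that]
    by (simp add: i_def[abs_def] power2_eq_square field_simps)
  have j': "(j has_real_derivative - d' z * r * j z ^ 2) (at z)" if "0 \<le> z" "z < 1" for z
    using DERIV_inverse_fun[OF v[of z]] pos(2)[OF that]
    by (simp add: j_def[abs_def] power2_eq_square field_simps)
  have G': "(G has_real_derivative G' z) (at z)" if "0 \<le> z" "z < 1" for z
    unfolding G_def G'_def
    by (auto intro!: derivative_eq_intros ln1 ln2 that simp: algebra_simps)
  have G'': "(G' has_real_derivative G'' z) (at z)" if "0 \<le> z" "z < 1" for z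
  proof -
    have "(G' has_real_derivative
       d' z * i z - (- d' z * i z + (1 - t - z) * (d'' z * i z + d' z ^ 2 * i z ^ 2)) + d' z * r * j z
        + (d' z * r * j z + (t + z) * (d'' z * r * j z - d' z ^ 2 * r ^ 2 * j z ^ 2)) - 4) (at z)"
      unfolding G'_def
      by (auto intro!: derivative_eq_intros ln1 ln2 i' j' that d''
          simp: algebra_simps power2_eq_square)
    moreover have "d' z * i z - (- d' z * i z + (1 - t - z) * (d'' z * i z + d' z ^ 2 * i z ^ 2))
        + d' z * r * j z
        + (d' z * r * j z + (t + z) * (d'' z * r * j z - d' z ^ 2 * r ^ 2 * j z ^ 2)) - 4
        = G'' z"
      using ij(1,2)[OF that] t unfolding G''_def by algebra
    ultimately show ?thesis
      by simp
  qed
  \<comment> \<open>At \<open>0\<close> the second derivative itself vanishes, so positivity is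
    available on the open interval only; together with continuity at the endpoints this still yields
    \<open>0 < G' z\<close> and then \<open>G 0 < G e\<close>.\<close>
  have "0 < G'' z" if "0 < z" "z < 1" for z
    unfolding G''_def d'_def d''_def
    using ij[of z] curvature_numerator_pos[OF that \<open>0 < r\<close>] that
    by (intro mult_pos_pos) auto
  moreover have "G' 0 = 0"
    using t by (simp add: G'_def tilt_def d'_def i_def j_def K_def L_def) algebra
  ultimately have "0 < G' z" if "0 < z" "z < 1" for z
    using DERIV_pos_imp_increasing_open[of 0 z G'] that G''
    by (smt (verit) DERIV_isCont continuous_at_imp_continuous_on atLeastAtMost_iff)
  then have "G 0 < G e"
    using DERIV_pos_imp_increasing_open[of 0 e G] assms G'
    by (smt (verit) DERIV_isCont continuous_at_imp_continuous_on atLeastAtMost_iff)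
  then show ?thesis
    by (simp add: G_def K_def L_def tilt_def r_def)
qed

subsection \<open>Order statistics of a uniform sample\<close>

text \<open>In a sorted list the entries below \<open>s\<close> form a prefix, and its length
  decides whether position \<open>k\<close> belongs to it.\<close>

lemma sorted_nth_less_iff:
  fixes xs :: "'a :: linorder list"
  assumes "sorted xs" "k < length xs"
  shows "xs ! k < s \<longleftrightarrow> k < length (filter (\<lambda>x. x < s) xs)"
  using assms
proof (induction xs arbitrary: k)
  case (Cons y ys)
  show ?case
  proof (cases "y < s")
    case True
    then show ?thesis
      using Cons by (cases k) auto
  next
    case False
    then have "\<forall>z\<in>set (y # ys). \<not> z < s"
      using Cons.prems(1) by auto
    then have "filter (\<lambda>x. x < s) (y # ys) = []" "\<not> (y # ys) ! k < s"
      using Cons.prems(2) by (auto simp: filter_empty_conv simp del: nth_Cons_pos) (metis nth_mem length_Cons set_ConsD)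
    then show ?thesis
      by simp
  qed
qed simp

text \<open>This is \<open>n\<close> times the left-continuous version of the empirical distribution
  function.\<close>

definition count_below :: "nat \<Rightarrow> (nat \<Rightarrow> real) \<Rightarrow> real \<Rightarrow> nat"
  where "count_below n u s = card {j \<in> {1..n}. u j < s}"

text \<open>Counts and order statistics are generalised inverses of each other. This turns events
  about the sorted sample into events about counts, which involve no sorting.\<close>

lemma order_stat_less_iff:
  assumes "i \<in> {1..n}"
  shows "order_stat n u i < s \<longleftrightarrow> i \<le> count_below n u s"
proof -
  have "length (filter (\<lambda>x. x < s) (sort (map u [1..<n + 1])))
      = length (filter (\<lambda>j. u j < s) [1..<n + 1])"
    by (simp add: filter_sort filter_map comp_def)
  also have "\<dots> = count_below n u s"
    by (auto simp: distinct_length_filter count_below_def intro!: arg_cong[where f = card])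
  finally have "order_stat n u i < s \<longleftrightarrow> i - 1 < count_below n u s"
    using assms unfolding order_stat_def
    by (subst sorted_nth_less_iff) (cases i; simp del: upt_Suc)+
  then show ?thesis
    using assms by auto
qed

lemma count_below_mono: "s \<le> t \<Longrightarrow> count_below n u s \<le> count_below n u t"
  unfolding count_below_def by (intro card_mono) auto

lemma count_below_le: "count_below n u s \<le> n"
proof -
  have "count_below n u s \<le> card {1..n}"
    unfolding count_below_def by (intro card_mono) auto
  then show ?thesis
    by simp
qed

lemma count_below_eq_0: "(\<And>j. j \<in> {1..n} \<Longrightarrow> s \<le> u j) \<Longrightarrow> count_below n u s = 0"
  unfolding count_below_def by (subst card_0_eq) force+

lemma count_below_eq_n:
  assumes "\<And>j. j \<in> {1..n} \<Longrightarrow> u j < s"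
  shows "count_below n u s = n"
proof -
  have "{j \<in> {1..n}. u j < s} = {1..n}"
    using assms by blast
  then show ?thesis
    by (simp add: count_below_def)
qed

section \<open>The uniform law on the cube, measurability of counts, and densities of
  products\<close>

definition unif :: "real measure"
  where "unif = restrict_space lborel {0..1}"

lemma unif_cube_eq: "unif_cube n = PiM {1..n} (\<lambda>_. unif)"
  by (simp add: unif_cube_def unif_def)

lemma space_unif [simp]: "space unif = {0..1}"
  by (simp add: unif_def space_restrict_space)

lemma sets_unif: "sets unif = sets (restrict_space borel {0..1})"
  unfolding unif_def by (intro sets_restrict_space_cong) simp

lemma emeasure_unif: "A \<subseteq> {0..1} \<Longrightarrow> emeasure unif A = emeasure lborel A"
  unfolding unif_def by (subst emeasure_restrict_space) auto

lemma id_unif_measurable [measurable]: "(\<lambda>x. x) \<in> borel_measurable unif"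
  unfolding unif_def by (intro measurable_restrict_space1) simp

lemma prob_space_unif: "prob_space unif"
  by (intro prob_spaceI) (simp add: emeasure_unif)

lemma prob_space_unif_cube: "prob_space (unif_cube n)"
  unfolding unif_cube_eq by (intro prob_space_PiM prob_space_unif)

lemma space_unif_cube: "space (unif_cube n) = {1..n} \<rightarrow>\<^sub>E {0..1}"
  by (simp add: unif_cube_eq space_PiM)

lemma component_unif_cube:
  assumes "u \<in> space (unif_cube n)" "j \<in> {1..n}"
  shows "0 \<le> u j" "u j \<le> 1"
  using assms PiE_mem[of u "{1..n}" "\<lambda>_. {0..1}" j] by (auto simp: space_unif_cube)

lemma component_unif_cube_measurable [measurable]:
  "j \<in> {1..n} \<Longrightarrow> (\<lambda>u. u j) \<in> borel_measurable (unif_cube n)"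
  unfolding unif_cube_eq
  by (rule measurable_compose[where f = "\<lambda>u. u j" and g = "\<lambda>x. x" and N = unif]) auto

text \<open>Ranging over the possible sets \<open>J\<close> of small coordinates presents the event
  as a finite union of finite intersections of conditions on single coordinates, which gives its
  measurability.\<close>

lemma count_below_ge_iff:
  "i \<le> count_below n u s \<longleftrightarrow> (\<exists>J\<in>{J. J \<subseteq> {1..n} \<and> i \<le> card J}. \<forall>j\<in>J. u j < s)"
proof
  assume "i \<le> count_below n u s"
  then show "\<exists>J\<in>{J. J \<subseteq> {1..n} \<and> i \<le> card J}. \<forall>j\<in>J. u j < s"
    unfolding count_below_def by (intro bexI[of _ "{j \<in> {1..n}. u j < s}"]) auto
next
  assume "\<exists>J\<in>{J. J \<subseteq> {1..n} \<and> i \<le> card J}. \<forall>j\<in>J. u j < s"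
  then obtain J where "J \<subseteq> {1..n}" "i \<le> card J" "\<forall>j\<in>J. u j < s"
    by auto
  moreover from this have "card J \<le> count_below n u s"
    unfolding count_below_def by (intro card_mono) auto
  ultimately show "i \<le> count_below n u s"
    by simp
qed

lemma count_below_ge_sets:
  "{u \<in> space (unif_cube n). i \<le> count_below n u s} \<in> sets (unif_cube n)"
proof -
  have "{u \<in> space (unif_cube n). i \<le> count_below n u s}
      = (\<Union>J\<in>{J. J \<subseteq> {1..n} \<and> i \<le> card J}. {u \<in> space (unif_cube n). \<forall>j\<in>J. u j < s})"
    unfolding count_below_ge_iff by blast
  also have "\<dots> \<in> sets (unif_cube n)"
  proof (intro sets.finite_UN)
    fix J assume "J \<in> {J. J \<subseteq> {1..n} \<and> i \<le> card J}"
    then have J: "J \<subseteq> {1..n}" "finite J"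
      using finite_subset by auto
    have "{u \<in> space (unif_cube n). u j < s} \<in> sets (unif_cube n)" if "j \<in> J" for j
      using J that by (intro borel_measurable_less) auto
    then show "{u \<in> space (unif_cube n). \<forall>j\<in>J. u j < s} \<in> sets (unif_cube n)"
      using J(2) by (intro sets.sets_Collect_finite_All)
  qed (simp add: finite_subset)
  finally show ?thesis .
qed

lemma count_below_measurable [measurable]:
  "(\<lambda>u. count_below n u s) \<in> measurable (unif_cube n) (count_space UNIV)"
proof -
  have "(\<lambda>u. count_below n u s) -` {i} \<inter> space (unif_cube n) \<in> sets (unif_cube n)" for i
  proof -
    have "(\<lambda>u. count_below n u s) -` {i} \<inter> space (unif_cube n)
        = {u \<in> space (unif_cube n). i \<le> count_below n u s}
          - {u \<in> space (unif_cube n). Suc i \<le> count_below n u s}"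
      by auto
    then show ?thesis
      using sets.Diff[OF count_below_ge_sets count_below_ge_sets] by simp
  qed
  then show ?thesis
    by (simp add: measurable_count_space_eq2_countable)
qed

lemma order_stat_measurable [measurable]:
  assumes "i \<in> {1..n}"
  shows "(\<lambda>u. order_stat n u i) \<in> borel_measurable (unif_cube n)"
  by (rule borel_measurableI_less) (simp only: order_stat_less_iff[OF assms] count_below_ge_sets)

text \<open>It suffices to compare the two measures on boxes. There the indicator factors over the
  coordinates, so the integral of the product density splits into a product of integrals.\<close>

lemma PiM_density:
  assumes "finite I" and f [measurable]: "f \<in> borel_measurable N"
    and "prob_space N" and "prob_space (density N f)"
  shows "PiM I (\<lambda>_. density N f) = density (PiM I (\<lambda>_. N)) (\<lambda>x. \<Prod>i\<in>I. f (x i))"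
proof -
  interpret N: product_prob_space "\<lambda>_. N" I
    using assms by (intro product_prob_spaceI)
  interpret D: product_prob_space "\<lambda>_. density N f" I
    using assms by (intro product_prob_spaceI)
  show ?thesis
  proof (rule D.PiM_eqI[symmetric])
    fix A assume "\<And>i. i \<in> I \<Longrightarrow> A i \<in> sets (density N f)"
    then have A: "A i \<in> sets N" if "i \<in> I" for i
      using that by simp
    have "emeasure (density (PiM I (\<lambda>_. N)) (\<lambda>x. \<Prod>i\<in>I. f (x i))) (Pi\<^sub>E I A)
        = (\<integral>\<^sup>+x. (\<Prod>i\<in>I. f (x i)) * indicator (Pi\<^sub>E I A) x \<partial>PiM I (\<lambda>_. N))"
      using A \<open>finite I\<close> by (subst emeasure_density) (auto intro!: sets_PiM_I_finite)
    also have "\<dots> = (\<integral>\<^sup>+x. (\<Prod>i\<in>I. f (x i) * indicator (A i) (x i)) \<partial>PiM I (\<lambda>_. N))"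
    proof (intro nn_integral_cong)
      fix x assume "x \<in> space (PiM I (\<lambda>_. N))"
      then have "indicator (Pi\<^sub>E I A) x = (\<Prod>i\<in>I. indicator (A i) (x i) :: ennreal)"
        using \<open>finite I\<close> by (auto simp: indicator_def space_PiM PiE_iff prod_zero_iff)
      then show "(\<Prod>i\<in>I. f (x i)) * indicator (Pi\<^sub>E I A) x = (\<Prod>i\<in>I. f (x i) * indicator (A i) (x i))"
        by (simp add: prod.distrib)
    qed
    also have "\<dots> = (\<Prod>i\<in>I. \<integral>\<^sup>+x. f x * indicator (A i) x \<partial>N)"
      using A \<open>finite I\<close>
      by (intro N.product_nn_integral_prod[where f = "\<lambda>i x. f x * indicator (A i) x"]) auto
    also have "\<dots> = (\<Prod>i\<in>I. emeasure (density N f) (A i))"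
      using A by (intro prod.cong) (auto simp: emeasure_density)
    finally show "emeasure (density (PiM I (\<lambda>_. N)) (\<lambda>x. \<Prod>i\<in>I. f (x i))) (Pi\<^sub>E I A)
        = (\<Prod>i\<in>I. emeasure (density N f) (A i))" .
  qed (use \<open>finite I\<close> in \<open>auto intro!: sets_PiM_cong\<close>)
qed

subsection \<open>The one-sided Dvoretzky--Kiefer--Wolfowitz--Massart inequality\<close>

text \<open>Forgets the positions of points below \<open>t\<close>. Invariance under this map,
  applied to each coordinate, expresses that an event sees only which points lie below
  \<open>t\<close> and the values of the others.\<close>

definition collapse :: "real \<Rightarrow> real \<Rightarrow> real"
  where "collapse t u = (if u < t then 0 else u)"

lemma collapse_measurable [measurable]: "collapse t \<in> measurable unif unif"
proof -
  have "collapse t \<in> borel_measurable unif"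
    unfolding collapse_def[abs_def] by measurable
  then show ?thesis
    unfolding measurable_cong_sets[OF refl sets_unif]
    by (intro measurable_restrict_space2) (auto simp: collapse_def)
qed

text \<open>Only points below \<open>t\<close> move, and their new position \<open>0\<close> is
  still below \<open>s\<close> since \<open>0 < t \<le> s\<close>.\<close>

lemma count_below_collapse:
  assumes "0 < t" "t \<le> s"
  shows "count_below n (compose {1..n} (collapse t) u) s = count_below n u s"
  using assms unfolding count_below_def
  by (intro arg_cong[where f = card]) (auto simp: compose_def collapse_def)

text \<open>Density of a mixture: weight \<open>1 - d\<close> on the uniform law of the unit
  interval and weight \<open>d\<close> on the uniform law of \<open>[0, t)\<close>.\<close>

definition tilt_density :: "real \<Rightarrow> real \<Rightarrow> real \<Rightarrow> ennreal"
  where "tilt_density d t u = ennreal (1 - d + (if u < t then d / t else 0))"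

lemma tilt_density_measurable [measurable]: "tilt_density d t \<in> borel_measurable unif"
  unfolding tilt_density_def[abs_def] by measurable

text \<open>A preimage under \<open>collapse t\<close> contains all of \<open>[0, t)\<close> or
  misses it, according to whether \<open>0\<close> lies in \<open>B\<close>. The part of the mixture
  living on \<open>[0, s)\<close> thus contributes \<open>d\<close> or nothing, whatever
  \<open>s\<close> is.\<close>

lemma emeasure_tilt_density_collapse:
  assumes "0 < s" "s \<le> t" "t \<le> 1" "0 \<le> d" "d \<le> 1" "B \<in> sets unif"
  defines "P \<equiv> collapse t -` B \<inter> space unif"
  shows "emeasure (density unif (tilt_density d s)) P
    = ennreal (1 - d) * emeasure unif P + (if 0 \<in> B then ennreal d else 0)"
proof -
  have P [measurable]: "P \<in> sets unif"
    unfolding P_def using assms by (intro measurable_sets[OF collapse_measurable])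
  have S [measurable]: "{0..<s} \<in> sets unif"
    using assms unfolding sets_unif by (subst sets_restrict_space_iff) auto
  have "emeasure (density unif (tilt_density d s)) P
      = (\<integral>\<^sup>+u. ennreal (1 - d) * indicator P u + ennreal (d / s) * indicator (P \<inter> {0..<s}) u \<partial>unif)"
    using assms(1-5)
    by (subst emeasure_density)
      (auto intro!: nn_integral_cong simp: tilt_density_def indicator_def ennreal_plus[symmetric]
        simp del: ennreal_plus)
  also have "\<dots> = ennreal (1 - d) * emeasure unif P + ennreal (d / s) * emeasure unif (P \<inter> {0..<s})"
    by (subst nn_integral_add) (auto simp: nn_integral_cmult)
  also have "P \<inter> {0..<s} = (if 0 \<in> B then {0..<s} else {})"
    using assms(1-3) by (auto simp: P_def collapse_def)
  also have "ennreal (d / s) * emeasure unif (if 0 \<in> B then {0..<s} else {})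
      = (if 0 \<in> B then ennreal d else 0)"
  proof -
    have "emeasure unif {0..<s} = ennreal s"
      using assms(1-3) by (subst emeasure_unif) auto
    then show ?thesis
      using assms(1-5) by (auto simp: ennreal_mult[symmetric])
  qed
  finally show ?thesis .
qed

lemma prob_space_tilt_density:
  assumes "0 < t" "t \<le> 1" "0 \<le> d" "d \<le> 1"
  shows "prob_space (density unif (tilt_density d t))"
proof (rule prob_spaceI)
  have "collapse t -` {0..1} \<inter> space unif = {0..1}"
    by (auto simp: collapse_def)
  moreover have "{0..1} \<in> sets unif"
    using sets.top[of unif] by simp
  moreover have "emeasure unif {0..1} = 1"
    by (simp add: emeasure_unif)
  ultimately show "emeasure (density unif (tilt_density d t)) (space (density unif (tilt_density d t))) = 1"
    using emeasure_tilt_density_collapse[of t t d "{0..1}"] assms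
    by (simp add: ennreal_plus[symmetric] del: ennreal_plus)
qed

lemma distr_collapse_tilt_density:
  assumes "0 < s" "s \<le> t" "t \<le> 1" "0 \<le> d" "d \<le> 1"
  shows "distr (density unif (tilt_density d s)) unif (collapse t)
    = distr (density unif (tilt_density d t)) unif (collapse t)"
proof (rule measure_eqI)
  fix B assume "B \<in> sets (distr (density unif (tilt_density d s)) unif (collapse t))"
  then have B: "B \<in> sets unif"
    by simp
  have "0 < t"
    using assms by simp
  show "emeasure (distr (density unif (tilt_density d s)) unif (collapse t)) B
      = emeasure (distr (density unif (tilt_density d t)) unif (collapse t)) B"
    using emeasure_tilt_density_collapse[OF assms B]
      emeasure_tilt_density_collapse[OF \<open>0 < t\<close> order.refl assms(3-5) B] B
    by (simp add: emeasure_distr)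
qed simp

definition tilted_cube :: "nat \<Rightarrow> real \<Rightarrow> real \<Rightarrow> (nat \<Rightarrow> real) measure"
  where "tilted_cube n d t = PiM {1..n} (\<lambda>_. density unif (tilt_density d t))"

lemma sets_tilted_cube [measurable_cong]: "sets (tilted_cube n d t) = sets (unif_cube n)"
  unfolding tilted_cube_def unif_cube_eq by (intro sets_PiM_cong) auto

lemma space_tilted_cube: "space (tilted_cube n d t) = space (unif_cube n)"
  by (rule sets_eq_imp_space_eq[OF sets_tilted_cube])

text \<open>An event that only sees which coordinates lie below \<open>t\<close> and the values of the others cannot
  tell the threshold \<open>s\<close> of the tilt from \<open>t\<close>; with threshold \<open>t\<close> the density is constant on it.\<close>

lemma measure_tilted_cube:
  assumes "0 < s" "s \<le> t" "t \<le> 1" "0 \<le> d" "d \<le> 1"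
    and A: "A \<in> sets (unif_cube n)"
    and count: "\<And>u. u \<in> A \<Longrightarrow> count_below n u t = i"
    and invariant: "\<And>u. u \<in> space (unif_cube n) \<Longrightarrow> compose {1..n} (collapse t) u \<in> A \<longleftrightarrow> u \<in> A"
  shows "measure (tilted_cube n d s) A
    = (1 - d + d / t) ^ i * (1 - d) ^ (n - i) * measure (unif_cube n) A"
proof -
  interpret prob_space "unif_cube n"
    by (rule prob_space_unif_cube)
  \<comment> \<open>Since \<open>A\<close> is invariant, its probability can be computed after
    collapsing each coordinate, and the collapsed law is the same for the thresholds
    \<open>s\<close> and \<open>t\<close>.\<close>
  have push: "emeasure (tilted_cube n d r) A
      = emeasure (PiM {1..n} (\<lambda>_. distr (density unif (tilt_density d r)) unif (collapse t))) A"
    if "0 < r" "r \<le> t" for r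
  proof -
    have meas: "compose {1..n} (collapse t) \<in> measurable (tilted_cube n d r) (unif_cube n)"
      unfolding tilted_cube_def unif_cube_eq compose_def[abs_def] by measurable
    have "compose {1..n} (collapse t) -` A \<inter> space (tilted_cube n d r) = A"
      using invariant sets.sets_into_space[OF A] by (auto simp: space_tilted_cube)
    then have "emeasure (tilted_cube n d r) A
        = emeasure (distr (tilted_cube n d r) (unif_cube n) (compose {1..n} (collapse t))) A"
      by (simp only: emeasure_distr[OF meas A])
    also have "distr (tilted_cube n d r) (unif_cube n) (compose {1..n} (collapse t))
        = PiM {1..n} (\<lambda>_. distr (density unif (tilt_density d r)) unif (collapse t))"
      unfolding tilted_cube_def unif_cube_eq using assms that
      by (intro distr_PiM_finite_prob_space' prob_space_unif prob_space_tilt_density) auto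
    finally show ?thesis .
  qed
  have dens: "(\<Prod>j\<in>{1..n}. tilt_density d t (u j)) = ennreal ((1 - d + d / t) ^ i * (1 - d) ^ (n - i))"
    if "u \<in> A" for u
  proof -
    have "(\<Prod>j\<in>{1..n}. tilt_density d t (u j))
        = ennreal (\<Prod>j\<in>{1..n}. 1 - d + (if u j < t then d / t else 0))"
      unfolding tilt_density_def using assms(1-5) by (intro prod_ennreal) auto
    also have "(\<Prod>j\<in>{1..n}. 1 - d + (if u j < t then d / t else 0))
        = (\<Prod>j\<in>{1..n}. if u j < t then 1 - d + d / t else 1 - d)"
      by (intro prod.cong) auto
    also have "\<dots> = (1 - d + d / t) ^ card ({1..n} \<inter> {j. u j < t})
        * (1 - d) ^ card ({1..n} \<inter> - {j. u j < t})"
      by (subst prod.If_cases) auto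
    also have "{1..n} \<inter> - {j. u j < t} = {1..n} - ({1..n} \<inter> {j. u j < t})"
      by auto
    also have "card \<dots> = n - card ({1..n} \<inter> {j. u j < t})"
      by (subst card_Diff_subset) auto
    also have "card ({1..n} \<inter> {j. u j < t}) = i"
      using count[OF that] by (simp add: count_below_def Int_def)
    finally show ?thesis .
  qed
  have "emeasure (tilted_cube n d s) A = emeasure (tilted_cube n d t) A"
    using assms push[of s] push[of t] distr_collapse_tilt_density[OF assms(1-5)] by simp
  also have "tilted_cube n d t = density (unif_cube n) (\<lambda>u. \<Prod>j\<in>{1..n}. tilt_density d t (u j))"
    unfolding tilted_cube_def unif_cube_eq using assms
    by (intro PiM_density prob_space_unif prob_space_tilt_density) auto
  also have "emeasure \<dots> A = (\<integral>\<^sup>+u. (\<Prod>j\<in>{1..n}. tilt_density d t (u j)) * indicator A u \<partial>unif_cube n)"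
    using A by (subst emeasure_density) (auto simp: unif_cube_eq)
  also have "\<dots> = (\<integral>\<^sup>+u. ennreal ((1 - d + d / t) ^ i * (1 - d) ^ (n - i)) * indicator A u \<partial>unif_cube n)"
    by (intro nn_integral_cong) (simp add: indicator_def dens del: One_nat_def)
  also have "\<dots> = ennreal ((1 - d + d / t) ^ i * (1 - d) ^ (n - i)) * emeasure (unif_cube n) A"
    using A by (simp add: nn_integral_cmult)
  finally show ?thesis
    using assms(1-5) by (simp add: measure_def enn2real_mult)
qed

text \<open>The event that \<open>U_(i) < i/n - e\<close> for some \<open>i\<close>, so that the
  empirical distribution function exceeds the identity by more than \<open>e\<close> somewhere. For
  \<open>e = beta_KS n \<alpha>\<close> its complement is the event that defines
  \<open>beta_KS\<close>.\<close>

definition exceedance :: "nat \<Rightarrow> real \<Rightarrow> (nat \<Rightarrow> real) set"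
  where "exceedance n e = {u \<in> space (unif_cube n).
    \<exists>i\<in>{1..n}. i \<le> count_below n u (real i / real n - e)}"

lemma exceedance_sets [measurable]: "exceedance n e \<in> sets (unif_cube n)"
  unfolding exceedance_def by (intro sets.sets_Collect_finite_Ex count_below_ge_sets) auto

text \<open>This is \<open>tilt_exponent\<close> at \<open>t + e = i/n\<close>, multiplied by
  \<open>n\<close> and exponentiated.\<close>

lemma tilt_weight:
  assumes "0 < e" "e < 1" "i \<in> {1..n}" "0 < real i / real n - e"
  defines "t \<equiv> real i / real n - e"
  shows "exp (2 * real n * e ^ 2)
    < (1 - tilt e + tilt e / t) ^ i * (1 - tilt e) ^ (n - i)"
proof -
  have n: "0 < real n"
    using assms by simp
  have i: "real i = real n * (t + e)" and ni: "real (n - i) = real n * (1 - t - e)"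
    using assms n by (auto simp: field_simps of_nat_diff)
  have "0 < t"
    using assms by (simp add: t_def)
  have "t + e \<le> 1"
    using assms n by (simp add: field_simps)
  have "tilt e < 1" "0 \<le> tilt e"
    using tilt_bounds[of e] assms by auto
  have eq: "1 + tilt e * ((1 - t) / t) = 1 - tilt e + tilt e / t"
    using assms by (simp add: field_simps)
  have pos: "0 < 1 - tilt e + tilt e / t"
    using assms \<open>tilt e < 1\<close> \<open>0 \<le> tilt e\<close> by (intro add_pos_nonneg) auto
  have "2 * e ^ 2 < (1 - t - e) * ln (1 - tilt e) + (t + e) * ln (1 - tilt e + tilt e / t)"
    using tilt_exponent[OF assms(1,2) \<open>0 < t\<close> \<open>t + e \<le> 1\<close>] by (simp only: eq)
  then have "real n * (2 * e ^ 2)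
      < real n * ((1 - t - e) * ln (1 - tilt e) + (t + e) * ln (1 - tilt e + tilt e / t))"
    using n by (rule mult_strict_left_mono)
  also have "\<dots> = real i * ln (1 - tilt e + tilt e / t) + real (n - i) * ln (1 - tilt e)"
    unfolding i ni by (simp add: algebra_simps)
  finally have "exp (real n * (2 * e ^ 2))
      < exp (real i * ln (1 - tilt e + tilt e / t) + real (n - i) * ln (1 - tilt e))"
    by simp
  also have "\<dots> = (1 - tilt e + tilt e / t) ^ i * (1 - tilt e) ^ (n - i)"
    using pos \<open>tilt e < 1\<close> by (simp add: exp_add exp_of_nat_mult)
  finally show ?thesis
    by (simp add: mult.commute mult.left_commute)
qed

lemma one_sided_DKW:
  assumes "n \<ge> 1" "0 < e" "e < 1"
  shows "measure (unif_cube n) (exceedance n e) < exp (- (2 * real n * e ^ 2))"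
proof -
  interpret U: prob_space "unif_cube n"
    by (rule prob_space_unif_cube)
  define t where "t i = real i / real n - e" for i
  define I where "I = {i \<in> {1..n}. 0 < t i}"
  \<comment> \<open>On \<open>A i\<close> the index \<open>i\<close> is the last crossing. Requiring
    the count to equal \<open>i\<close>, rather than to be at least \<open>i\<close>, is what makes
    the tilted density constant there.\<close>
  define A where "A i = {u \<in> space (unif_cube n). count_below n u (t i) = i
    \<and> (\<forall>k\<in>{i<..n}. count_below n u (t k) < k)}" for i
  have "finite I" "n \<in> I"
    using assms by (auto simp: I_def t_def)
  \<comment> \<open>A threshold below every \<open>t i\<close> gives a single tilted law that serves
    all pieces, so that their tilted probabilities can be added.\<close>
  define s where "s = Min (t ` I)"
  have s_le: "s \<le> t i" if "i \<in> I" for i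
    using \<open>finite I\<close> that by (auto simp: s_def)
  have "s \<in> t ` I"
    unfolding s_def using \<open>finite I\<close> \<open>n \<in> I\<close> by (intro Min_in) auto
  then have "0 < s"
    by (auto simp: I_def)
  have t_mono: "t i \<le> t k" if "i \<le> k" for i k
    using that by (simp add: t_def divide_right_mono)
  have t_le: "t i \<le> 1" if "i \<in> I" for i
  proof -
    have "real i / real n \<le> 1"
      using that assms by (simp add: I_def)
    then show ?thesis
      using assms unfolding t_def by linarith
  qed
  have "s \<le> 1"
    using s_le[OF \<open>n \<in> I\<close>] t_le[OF \<open>n \<in> I\<close>] by simp
  define d where "d = tilt e"
  have d: "0 \<le> d" "d \<le> 1"
    using tilt_bounds[of e] assms by (auto simp: d_def)
  interpret Q: prob_space "tilted_cube n d s"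
    unfolding tilted_cube_def using d \<open>0 < s\<close> \<open>s \<le> 1\<close>
    by (intro prob_space_PiM prob_space_tilt_density) auto
  have A_sets [measurable]: "A i \<in> sets (unif_cube n)" for i
    unfolding A_def by measurable
  have disjoint: "A i \<inter> A k = {}" if "i < k" "k \<in> I" for i k
  proof -
    have False if "u \<in> A i" "u \<in> A k" for u
    proof -
      have "k \<in> {i<..n}"
        using \<open>i < k\<close> \<open>k \<in> I\<close> by (auto simp: I_def)
      then have "count_below n u (t k) < k"
        using \<open>u \<in> A i\<close> by (simp add: A_def)
      then show False
        using \<open>u \<in> A k\<close> by (simp add: A_def)
    qed
    then show ?thesis
      by blast
  qed
  then have disj: "disjoint_family_on A I"
    unfolding disjoint_family_on_def by (metis inf_commute nat_neq_iff)
  have "exceedance n e \<subseteq> (\<Union>i\<in>I. A i)"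
  proof
    fix u assume u: "u \<in> exceedance n e"
    then have "u \<in> space (unif_cube n)"
      by (simp add: exceedance_def)
    define K where "K = {i \<in> {1..n}. i \<le> count_below n u (t i)}"
    define i where "i = Max K"
    have "finite K" "K \<noteq> {}"
      using u by (auto simp: K_def exceedance_def t_def)
    then have "i \<in> K" and max: "\<And>k. k \<in> K \<Longrightarrow> k \<le> i"
      by (auto simp: i_def)
    then have i: "i \<in> {1..n}" "i \<le> count_below n u (t i)"
      by (auto simp: K_def)
    have above: "count_below n u (t k) < k" if "k \<in> {i<..n}" for k
      using max[of k] that i by (fastforce simp: K_def)
    \<comment> \<open>For \<open>i < n\<close> there is no crossing at \<open>i + 1\<close>: at most
      \<open>i\<close> points lie below \<open>t (Suc i)\<close>, hence at most \<open>i\<close>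
      below the smaller \<open>t i\<close>.\<close>
    have "count_below n u (t i) \<le> i"
    proof (cases "i = n")
      case False
      then show ?thesis
        using count_below_mono[OF t_mono[of i "Suc i"], of n u] above[of "Suc i"] i by auto
    qed (simp add: count_below_le)
    moreover have "0 < t i"
    proof (rule ccontr)
      assume "\<not> 0 < t i"
      then have "t i \<le> u j" if "j \<in> {1..n}" for j
        using component_unif_cube(1)[OF \<open>u \<in> space (unif_cube n)\<close> that] by linarith
      then have "count_below n u (t i) = 0"
        by (rule count_below_eq_0)
      then show False
        using i by simp
    qed
    ultimately show "u \<in> (\<Union>i\<in>I. A i)"
      using i above \<open>u \<in> space (unif_cube n)\<close> by (auto simp: I_def A_def)
  qed
  then have "measure (unif_cube n) (exceedance n e) \<le> measure (unif_cube n) (\<Union>i\<in>I. A i)"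
    using \<open>finite I\<close> by (intro U.finite_measure_mono) auto
  also have "\<dots> = (\<Sum>i\<in>I. measure (unif_cube n) (A i))"
    using \<open>finite I\<close> disj by (intro U.finite_measure_finite_Union) auto
  finally have le: "measure (unif_cube n) (exceedance n e) \<le> (\<Sum>i\<in>I. measure (unif_cube n) (A i))" .
  define w where "w i = (1 - d + d / t i) ^ i * (1 - d) ^ (n - i)" for i
  have w: "exp (2 * real n * e ^ 2) < w i" if "i \<in> I" for i
    using that assms tilt_weight[of e i n] by (auto simp: I_def t_def w_def d_def)
  \<comment> \<open>A common lower bound for the weights keeps the final inequality strict without
    knowing that any piece has positive probability.\<close>
  define W where "W = Min (w ` I)"
  have W: "exp (2 * real n * e ^ 2) < W"
    using \<open>finite I\<close> \<open>n \<in> I\<close> w unfolding W_def by (subst Min_gr_iff) auto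
  have "W * (\<Sum>i\<in>I. measure (unif_cube n) (A i)) \<le> (\<Sum>i\<in>I. w i * measure (unif_cube n) (A i))"
    unfolding sum_distrib_left W_def using \<open>finite I\<close>
    by (intro sum_mono mult_right_mono) auto
  also have "\<dots> = (\<Sum>i\<in>I. measure (tilted_cube n d s) (A i))"
  proof (intro sum.cong refl)
    fix i assume "i \<in> I"
    have "compose {1..n} (collapse (t i)) u \<in> A i \<longleftrightarrow> u \<in> A i" if "u \<in> space (unif_cube n)" for u
    proof -
      have "compose {1..n} (collapse (t i)) u \<in> space (unif_cube n)"
        using that by (auto simp: space_unif_cube compose_def collapse_def PiE_iff)
      then show ?thesis
        using that \<open>i \<in> I\<close> count_below_collapse[of "t i" "t _" n u] t_mono
        by (auto simp: A_def I_def)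
    qed
    then show "w i * measure (unif_cube n) (A i) = measure (tilted_cube n d s) (A i)"
      unfolding w_def using \<open>0 < s\<close> s_le[OF \<open>i \<in> I\<close>] t_le[OF \<open>i \<in> I\<close>] d
      by (intro measure_tilted_cube[symmetric]) (auto simp: A_def[of i])
  qed
  also have "\<dots> = measure (tilted_cube n d s) (\<Union>i\<in>I. A i)"
    using \<open>finite I\<close> disj
    by (intro Q.finite_measure_finite_Union[symmetric]) (auto simp: sets_tilted_cube)
  also have "\<dots> \<le> 1"
    by simp
  finally have "W * (\<Sum>i\<in>I. measure (unif_cube n) (A i)) \<le> 1" .
  moreover have "0 < W"
    using W by (rule less_trans[OF exp_gt_zero])
  ultimately have "(\<Sum>i\<in>I. measure (unif_cube n) (A i)) \<le> 1 / W"
    by (simp add: pos_le_divide_eq mult.commute)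
  with le have "measure (unif_cube n) (exceedance n e) \<le> 1 / W"
    by (rule order.trans)
  also have "\<dots> < 1 / exp (2 * real n * e ^ 2)"
    using W \<open>0 < W\<close> by (intro divide_strict_left_mono) auto
  finally show ?thesis
    by (simp add: exp_minus field_simps)
qed

subsection \<open>The one-sided Kolmogorov--Smirnov quantile\<close>

lemma exceedance_antimono: "e \<le> e' \<Longrightarrow> exceedance n e' \<subseteq> exceedance n e"
  unfolding exceedance_def
  by (blast intro: order.trans count_below_mono diff_left_mono)

lemma measure_slab_le:
  assumes "j \<in> {1..n}" "a \<le> b"
  shows "measure (unif_cube n) {u \<in> space (unif_cube n). a \<le> u j \<and> u j < b} \<le> b - a"
proof -
  have [measurable]: "{0..1} \<inter> {a..<b} \<in> sets unif"
    unfolding sets_unif by (subst sets_restrict_space_iff) auto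
  have "{u \<in> space (unif_cube n). a \<le> u j \<and> u j < b}
      = (\<lambda>u. u j) -` ({0..1} \<inter> {a..<b}) \<inter> space (PiM {1..n} (\<lambda>_. unif))"
    using assms(1) by (fastforce simp: unif_cube_eq space_PiM PiE_iff)
  then have "emeasure (unif_cube n) {u \<in> space (unif_cube n). a \<le> u j \<and> u j < b}
      = emeasure (distr (PiM {1..n} (\<lambda>_. unif)) unif (\<lambda>u. u j)) ({0..1} \<inter> {a..<b})"
    using assms(1) by (simp add: emeasure_distr unif_cube_eq del: One_nat_def)
  also have "distr (PiM {1..n} (\<lambda>_. unif)) unif (\<lambda>u. u j) = unif"
    using assms(1) prob_space_unif by (intro distr_PiM_component) auto
  also have "emeasure unif ({0..1} \<inter> {a..<b}) = emeasure lborel ({0..1} \<inter> {a..<b})"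
    by (intro emeasure_unif) auto
  also have "\<dots> \<le> emeasure lborel {a..<b}"
    by (intro emeasure_mono) auto
  also have "\<dots> = ennreal (b - a)"
    using assms by simp
  finally show ?thesis
    using assms by (simp add: measure_def enn2real_leI)
qed

text \<open>If an exceedance of \<open>e\<close> is not one of \<open>e'\<close>, some coordinate
  lies in a slab \<open>[i/n - e', i/n - e)\<close>. There are \<open>n * n\<close> pairs of an
  index \<open>i\<close> and a coordinate, each contributing probability at most
  \<open>e' - e\<close>.\<close>

lemma measure_exceedance_lipschitz:
  assumes "e \<le> e'"
  shows "measure (unif_cube n) (exceedance n e)
    \<le> measure (unif_cube n) (exceedance n e') + real n * real n * (e' - e)"
proof -
  interpret prob_space "unif_cube n"
    by (rule prob_space_unif_cube)
  define slab where "slab p = {u \<in> space (unif_cube n).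
    real (fst p) / real n - e' \<le> u (snd p) \<and> u (snd p) < real (fst p) / real n - e}" for p
  have [measurable]: "slab p \<in> sets (unif_cube n)" if "p \<in> {1..n} \<times> {1..n}" for p
  proof -
    have "snd p \<in> {1..n}"
      using that by auto
    then show ?thesis
      unfolding slab_def by measurable
  qed
  have sub: "exceedance n e \<subseteq> exceedance n e' \<union> (\<Union>p\<in>{1..n} \<times> {1..n}. slab p)"
  proof
    fix u assume u: "u \<in> exceedance n e"
    then obtain i where i: "i \<in> {1..n}" "i \<le> count_below n u (real i / real n - e)"
      and "u \<in> space (unif_cube n)"
      by (auto simp: exceedance_def)
    show "u \<in> exceedance n e' \<union> (\<Union>p\<in>{1..n} \<times> {1..n}. slab p)"
    proof (cases "\<exists>j\<in>{1..n}. u \<in> slab (i, j)")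
      case True
      then show ?thesis
        using i by blast
    next
      case False
      then have "u j < real i / real n - e \<longleftrightarrow> u j < real i / real n - e'" if "j \<in> {1..n}" for j
      proof -
        have "u \<notin> slab (i, j)"
          using False that by blast
        then have "u j < real i / real n - e' \<or> real i / real n - e \<le> u j"
          using \<open>u \<in> space (unif_cube n)\<close> by (simp add: slab_def not_le not_less)
        then show ?thesis
          using assms by linarith
      qed
      then have "count_below n u (real i / real n - e) = count_below n u (real i / real n - e')"
        unfolding count_below_def by (intro arg_cong[where f = card]) blast
      then show ?thesis
        using i \<open>u \<in> space (unif_cube n)\<close> by (auto simp: exceedance_def)
    qed
  qed
  have "measure (unif_cube n) (exceedance n e)
      \<le> measure (unif_cube n) (exceedance n e' \<union> (\<Union>p\<in>{1..n} \<times> {1..n}. slab p))"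
    by (intro finite_measure_mono[OF sub] sets.Un sets.finite_UN) auto
  also have "\<dots> \<le> measure (unif_cube n) (exceedance n e')
      + measure (unif_cube n) (\<Union>p\<in>{1..n} \<times> {1..n}. slab p)"
    by (intro measure_Un_le sets.finite_UN) auto
  also have "measure (unif_cube n) (\<Union>p\<in>{1..n} \<times> {1..n}. slab p)
      \<le> (\<Sum>p\<in>{1..n} \<times> {1..n}. measure (unif_cube n) (slab p))"
    by (intro measure_UNION_le) auto
  also have "\<dots> \<le> (\<Sum>p\<in>{1..n} \<times> {1..n}. e' - e)"
  proof (intro sum_mono)
    fix p assume p: "p \<in> {1..n} \<times> {1..n}"
    then show "measure (unif_cube n) (slab p) \<le> e' - e"
      using measure_slab_le[of "snd p" n "real (fst p) / real n - e'" "real (fst p) / real n - e"] assms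
      by (auto simp: slab_def)
  qed
  also have "\<dots> = real n * real n * (e' - e)"
    by (simp add: card_cartesian_product)
  finally show ?thesis
    by simp
qed

lemma continuous_on_measure_exceedance:
  "continuous_on UNIV (\<lambda>e. measure (unif_cube n) (exceedance n e))"
proof (rule continuous_on_subset[OF lipschitz_on_continuous_on])
  interpret prob_space "unif_cube n"
    by (rule prob_space_unif_cube)
  show "(real n * real n)-lipschitz_on UNIV (\<lambda>e. measure (unif_cube n) (exceedance n e))"
  proof (rule lipschitz_on_leI)
    fix e e' :: real assume "e \<le> e'"
    moreover have "measure (unif_cube n) (exceedance n e') \<le> measure (unif_cube n) (exceedance n e)"
      using exceedance_antimono[OF \<open>e \<le> e'\<close>] by (intro finite_measure_mono) auto
    ultimately show "dist (measure (unif_cube n) (exceedance n e)) (measure (unif_cube n) (exceedance n e'))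
        \<le> real n * real n * dist e e'"
      using measure_exceedance_lipschitz[of e e' n] by (simp add: dist_real_def)
  qed simp
qed simp

text \<open>Already at index \<open>n\<close> the threshold \<open>1 - e\<close> lies above the
  whole unit interval.\<close>

lemma measure_exceedance_neg:
  assumes "n \<ge> 1" "e < 0"
  shows "measure (unif_cube n) (exceedance n e) = 1"
proof -
  interpret prob_space "unif_cube n"
    by (rule prob_space_unif_cube)
  have "count_below n u (real n / real n - e) = n" if "u \<in> space (unif_cube n)" for u
    using component_unif_cube[OF that] assms by (intro count_below_eq_n) force
  then have "exceedance n e = space (unif_cube n)"
    using assms by (auto simp: exceedance_def intro!: bexI[of _ n])
  then show ?thesis
    by (simp add: prob_space)
qed

lemma measure_exceedance_ge_1:
  assumes "e \<ge> 1"
  shows "measure (unif_cube n) (exceedance n e) = 0"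
proof -
  have "count_below n u (real i / real n - e) = 0"
    if "u \<in> space (unif_cube n)" "i \<in> {1..n}" for u i
  proof -
    have "real i / real n \<le> 1"
      using that(2) by simp
    then have "real i / real n - e \<le> u j" if "j \<in> {1..n}" for j
      using component_unif_cube(1)[OF \<open>u \<in> space (unif_cube n)\<close> that] assms by linarith
    then show ?thesis
      by (rule count_below_eq_0)
  qed
  then have "exceedance n e = {}"
    by (fastforce simp: exceedance_def)
  then show ?thesis
    by simp
qed

text \<open>On the box where all coordinates lie in \<open>[1 - e', 1 - e)\<close>, the empirical distribution
  function exceeds the identity by more than \<open>e\<close>, but not by more than \<open>e'\<close>.\<close>

lemma measure_exceedance_strict_antimono:
  assumes "n \<ge> 1" "0 \<le> e" "e < e'" "e' \<le> 1"
  shows "measure (unif_cube n) (exceedance n e') < measure (unif_cube n) (exceedance n e)"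
proof -
  interpret prob_space "unif_cube n"
    by (rule prob_space_unif_cube)
  interpret U: product_prob_space "\<lambda>_. unif" "{1..n}"
    using prob_space_unif by (intro product_prob_spaceI)
  define B where "B = {1..n} \<rightarrow>\<^sub>E {1 - e'..<1 - e}"
  have I: "{1 - e'..<1 - e} \<in> sets unif"
    using assms unfolding sets_unif by (subst sets_restrict_space_iff) auto
  have B: "B \<in> sets (unif_cube n)"
    unfolding B_def unif_cube_eq using I by (intro sets_PiM_I_finite) auto
  have "emeasure (unif_cube n) B = (\<Prod>i\<in>{1..n}. emeasure unif {1 - e'..<1 - e})"
    unfolding B_def unif_cube_eq using I by (intro U.emeasure_PiM) auto
  also have "emeasure unif {1 - e'..<1 - e} = ennreal (e' - e)"
    using assms by (subst emeasure_unif) auto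
  finally have "measure (unif_cube n) B = (e' - e) ^ n"
    using assms by (simp add: measure_def ennreal_power)
  then have pos: "0 < measure (unif_cube n) B"
    using assms by simp
  have box: "1 - e' \<le> u j" "u j < 1 - e" if "u \<in> B" "j \<in> {1..n}" for u j
    using that PiE_mem[of u "{1..n}" "\<lambda>_. {1 - e'..<1 - e}" j] by (auto simp: B_def)
  have "u \<in> exceedance n e" if "u \<in> B" for u
  proof -
    have "count_below n u (real n / real n - e) = n"
      using box[OF that] assms by (intro count_below_eq_n) force
    then show ?thesis
      using assms that sets.sets_into_space[OF B] by (auto simp: exceedance_def intro!: bexI[of _ n])
  qed
  moreover have "u \<notin> exceedance n e'" if "u \<in> B" for u
  proof -
    have "count_below n u (real i / real n - e') = 0" if "i \<in> {1..n}" for i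
    proof -
      have "real i / real n \<le> 1"
        using that by simp
      then have "real i / real n - e' \<le> u j" if "j \<in> {1..n}" for j
        using box(1)[OF \<open>u \<in> B\<close> that] by linarith
      then show ?thesis
        by (rule count_below_eq_0)
    qed
    then show ?thesis
      by (fastforce simp: exceedance_def)
  qed
  ultimately have "B \<inter> exceedance n e' = {}" "B \<union> exceedance n e' \<subseteq> exceedance n e"
    using exceedance_antimono[of e e' n] assms by auto
  then have "measure (unif_cube n) B + measure (unif_cube n) (exceedance n e')
      \<le> measure (unif_cube n) (exceedance n e)"
    using B by (subst finite_measure_Union[symmetric]) (auto intro!: finite_measure_mono)
  then show ?thesis
    using pos by simp
qed

text \<open>This makes the definite description in \<open>beta_KS\<close> well defined. Existence is
  the intermediate value theorem between \<open>-1\<close> and \<open>1\<close>, where the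
  probabilities are \<open>1\<close> and \<open>0\<close>; a solution must lie in
  \<open>[0, 1]\<close>, where the probability is strictly decreasing.\<close>

lemma ex1_measure_exceedance:
  assumes "n \<ge> 1" "0 < \<alpha>" "\<alpha> < 1"
  shows "\<exists>!e. measure (unif_cube n) (exceedance n e) = \<alpha>"
proof -
  have "\<exists>e\<ge>-1. e \<le> 1 \<and> measure (unif_cube n) (exceedance n e) = \<alpha>"
    using assms measure_exceedance_neg[of n "-1"] measure_exceedance_ge_1[of 1 n]
    by (intro IVT2' continuous_on_subset[OF continuous_on_measure_exceedance]) auto
  then obtain e where e: "measure (unif_cube n) (exceedance n e) = \<alpha>"
    by blast
  have range: "0 \<le> x" "x \<le> 1" if "measure (unif_cube n) (exceedance n x) = \<alpha>" for x
    using assms that measure_exceedance_neg[of n x] measure_exceedance_ge_1[of x n] by force+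
  show ?thesis
  proof (rule ex1I[of _ e])
    fix x assume x: "measure (unif_cube n) (exceedance n x) = \<alpha>"
    show "x = e"
      using measure_exceedance_strict_antimono[of n x e] measure_exceedance_strict_antimono[of n e x]
        range[OF x] range[OF e] x e assms by (cases x e rule: linorder_cases) auto
  qed (fact e)
qed

lemma order_stat_ge_event:
  "{u \<in> space (unif_cube n). \<forall>i\<in>{1..n}. order_stat n u i \<ge> real i / real n - e}
    = space (unif_cube n) - exceedance n e"
  using order_stat_less_iff[of _ n] by (auto simp: exceedance_def not_less[symmetric])

lemma measure_exceedance_beta_KS:
  assumes "n \<ge> 1" "0 < \<alpha>" "\<alpha> < 1"
  shows "measure (unif_cube n) (exceedance n (beta_KS n \<alpha>)) = \<alpha>"
proof -
  interpret prob_space "unif_cube n"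
    by (rule prob_space_unif_cube)
  have "beta_KS n \<alpha> = (THE e. measure (unif_cube n) (exceedance n e) = \<alpha>)"
    unfolding beta_KS_def order_stat_ge_event by (simp add: prob_compl)
  then show ?thesis
    using theI'[OF ex1_measure_exceedance[OF assms]] by simp
qed

lemma beta_KS_nonneg:
  assumes "n \<ge> 1" "0 < \<alpha>" "\<alpha> < 1"
  shows "0 \<le> beta_KS n \<alpha>"
  using measure_exceedance_beta_KS[OF assms] measure_exceedance_neg[of n "beta_KS n \<alpha>"] assms
  by force

lemma beta_KS_less_1:
  assumes "n \<ge> 1" "0 < \<alpha>" "\<alpha> < 1"
  shows "beta_KS n \<alpha> < 1"
  using measure_exceedance_beta_KS[OF assms] measure_exceedance_ge_1[of "beta_KS n \<alpha>" n] assms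
  by force

text \<open>The right-hand side \<open>e\<close> solves
  \<open>exp (- (2 * n * e ^ 2)) = \<alpha>\<close>. For \<open>e < 1\<close>, a quantile of at
  least \<open>e\<close> would give the exceedance of \<open>e\<close> probability at least
  \<open>\<alpha>\<close>, against the strict tail bound; for \<open>e \<ge> 1\<close> it is enough
  that the quantile is below \<open>1\<close>.\<close>

lemma beta_KS_less:
  assumes "n \<ge> 1" "0 < \<alpha>" "\<alpha> < 1"
  shows "beta_KS n \<alpha> < sqrt (ln (1 / \<alpha>) / (2 * real n))"
proof -
  interpret prob_space "unif_cube n"
    by (rule prob_space_unif_cube)
  define e where "e = sqrt (ln (1 / \<alpha>) / (2 * real n))"
  have pos: "0 < ln (1 / \<alpha>) / (2 * real n)"
    using assms by (intro divide_pos_pos) auto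
  then have "0 < e"
    by (simp add: e_def)
  have "e ^ 2 = ln (1 / \<alpha>) / (2 * real n)"
    unfolding e_def using pos by (intro real_sqrt_pow2) simp
  then have "2 * real n * e ^ 2 = - ln \<alpha>"
    using assms by (simp add: ln_div)
  then have alpha: "exp (- (2 * real n * e ^ 2)) = \<alpha>"
    using assms by simp
  show ?thesis
  proof (cases "e < 1")
    case True
    show ?thesis
    proof (rule ccontr)
      assume "\<not> ?thesis"
      then have "exceedance n (beta_KS n \<alpha>) \<subseteq> exceedance n e"
        by (intro exceedance_antimono) (simp add: e_def)
      then have "\<alpha> \<le> measure (unif_cube n) (exceedance n e)"
        using measure_exceedance_beta_KS[OF assms]
          finite_measure_mono[of "exceedance n (beta_KS n \<alpha>)" "exceedance n e"] by simp
      then show False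
        using one_sided_DKW[OF assms(1) \<open>0 < e\<close> True] alpha by simp
    qed
  next
    case False
    then show ?thesis
      using beta_KS_less_1[OF assms] unfolding e_def by linarith
  qed
qed

subsection \<open>The Anderson bound\<close>

lemma order_stat_mem:
  assumes "i \<in> {1..n}"
  shows "order_stat n v i \<in> v ` {1..n}"
proof -
  have "order_stat n v i \<in> set (sort (map v [1..<n + 1]))"
    unfolding order_stat_def using assms by (intro nth_mem) (cases i; simp del: upt_Suc)
  then show ?thesis
    by (simp add: atLeastLessThanSuc_atLeastAtMost del: upt_Suc)
qed

lemma order_stat_mono:
  assumes "1 \<le> i" "i \<le> j" "j \<le> n"
  shows "order_stat n v i \<le> order_stat n v j"
  unfolding order_stat_def using assms
  by (intro sorted_nth_mono) (cases j; simp del: upt_Suc)+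

lemma order_stat_eq:
  assumes "\<And>i j. 1 \<le> i \<Longrightarrow> i \<le> j \<Longrightarrow> j \<le> n \<Longrightarrow> v i \<le> v j" and "i \<in> {1..n}"
  shows "order_stat n v i = v i"
proof -
  have "sorted (map v [1..<n + 1])"
    unfolding sorted_iff_nth_mono using assms(1) by (simp del: upt_Suc)
  then have "sort (map v [1..<n + 1]) = map v [1..<n + 1]"
    by (rule sorted_sort_id)
  then show ?thesis
    using assms(2) unfolding order_stat_def by (cases i) (auto simp del: upt_Suc)
qed

lemma sum_order_stat: "(\<Sum>i = 1..n. order_stat n v i) = (\<Sum>i = 1..n. v i)"
proof -
  define xs where "xs = sort (map v [1..<n + 1])"
  have "(\<Sum>i = 1..n. order_stat n v i) = (\<Sum>k<n. xs ! k)"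
    unfolding order_stat_def xs_def[symmetric]
    by (rule sum.reindex_bij_witness[of _ Suc "\<lambda>i. i - 1"]) auto
  also have "\<dots> = sum_list xs"
    by (simp add: sum_list_sum_nth xs_def atLeast0LessThan del: upt_Suc)
  also have "\<dots> = sum_list (map v [1..<n + 1])"
    unfolding xs_def by (metis mset_sort sum_mset_sum_list)
  also have "\<dots> = (\<Sum>i = 1..n. v i)"
    by (simp add: sum_list_distinct_conv_sum_set atLeastLessThanSuc_atLeastAtMost del: upt_Suc)
  finally show ?thesis .
qed

text \<open>Spacings of the sorted vector, the last one measured up to \<open>b\<close>, the
  supremum of \<open>{..b}\<close>. For fixed \<open>l\<close> the function \<open>m_fun\<close> is
  affine in them.\<close>

definition gap :: "nat \<Rightarrow> real \<Rightarrow> (nat \<Rightarrow> real) \<Rightarrow> nat \<Rightarrow> real"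
  where "gap n b z i = ((order_stat n z)(n + 1 := b)) (i + 1) - order_stat n z i"

lemma m_fun_gap: "m_fun n {..b} z l = b - (\<Sum>i = 1..n. order_stat n l i * gap n b z i)"
  unfolding m_fun_alt Let_def gap_def by (auto intro!: sum.cong)

lemma gap_nonneg:
  assumes "z \<in> {1..n} \<rightarrow>\<^sub>E {..b}" "i \<in> {1..n}"
  shows "0 \<le> gap n b z i"
proof (cases "i = n")
  case True
  have "order_stat n z i \<le> b"
    using order_stat_mem[OF assms(2), of z] assms(1) by (auto simp: PiE_iff)
  then show ?thesis
    using True by (simp add: gap_def)
next
  case False
  then show ?thesis
    using order_stat_mono[of i "i + 1" n z] assms(2) by (auto simp: gap_def)
qed

lemma sum_gap:
  assumes "n \<ge> 1"
  shows "(\<Sum>i = 1..n. gap n b z i) = b - order_stat n z 1"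
proof -
  define X where "X = (order_stat n z)(n + 1 := b)"
  have "(\<Sum>i = 1..n. gap n b z i) = (\<Sum>i = 1..n. X (Suc i) - X i)"
    by (intro sum.cong) (auto simp: gap_def X_def)
  also have "\<dots> = X (Suc n) - X 1"
    by (rule sum_Suc_diff) simp
  finally show ?thesis
    using assms by (simp add: X_def)
qed

text \<open>Summation by parts, combined with the fact that sorting preserves the sum.\<close>

lemma sum_index_gap: "(\<Sum>i = 1..n. real i * gap n b z i) = real n * b - (\<Sum>i = 1..n. z i)"
proof -
  define X where "X = (order_stat n z)(n + 1 := b)"
  have "(\<Sum>i = 1..k. real i * (X (i + 1) - X i)) = real k * X (k + 1) - (\<Sum>i = 1..k. X i)" for k
    by (induction k) (simp_all add: algebra_simps)
  moreover have "(\<Sum>i = 1..n. real i * gap n b z i) = (\<Sum>i = 1..n. real i * (X (i + 1) - X i))"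
    by (intro sum.cong) (auto simp: gap_def X_def)
  moreover have "(\<Sum>i = 1..n. X i) = (\<Sum>i = 1..n. z i)"
    unfolding sum_order_stat[of n z, symmetric] by (intro sum.cong) (auto simp: X_def)
  moreover have "X (n + 1) = b"
    by (simp add: X_def)
  ultimately show ?thesis
    by metis
qed

text \<open>Replace the order statistics of \<open>l\<close> by their lower bounds
  \<open>i/n - \<beta>\<close>. The part with \<open>i/n\<close> produces the mean, and the part
  with \<open>\<beta>\<close> produces \<open>\<beta>\<close> times the total spacing, which is at
  most \<open>b - a\<close>.\<close>

lemma m_fun_le_mean:
  assumes "n \<ge> 1" "a \<le> b" "0 \<le> \<beta>" "x \<in> {1..n} \<rightarrow>\<^sub>E {a..b}"
    and l: "\<And>i. i \<in> {1..n} \<Longrightarrow> real i / real n - \<beta> \<le> order_stat n l i"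
  shows "m_fun n {..b} x l \<le> (\<Sum>i = 1..n. x i) / real n + \<beta> * (b - a)"
proof -
  have x: "x \<in> {1..n} \<rightarrow>\<^sub>E {..b}"
    using assms(4) by (auto simp: PiE_iff)
  have "order_stat n x 1 \<ge> a"
    using order_stat_mem[of 1 n x] assms(1,4) by (auto simp: PiE_iff)
  then have "\<beta> * (b - order_stat n x 1) \<le> \<beta> * (b - a)"
    using \<open>0 \<le> \<beta>\<close> by (intro mult_left_mono) auto
  moreover have "(\<Sum>i = 1..n. (real i / real n - \<beta>) * gap n b x i)
      \<le> (\<Sum>i = 1..n. order_stat n l i * gap n b x i)"
    using l gap_nonneg[OF x] by (intro sum_mono mult_right_mono) auto
  moreover have "(\<Sum>i = 1..n. (real i / real n - \<beta>) * gap n b x i)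
      = (\<Sum>i = 1..n. real i * gap n b x i) / real n - \<beta> * (\<Sum>i = 1..n. gap n b x i)"
    by (simp add: sum_subtractf left_diff_distrib sum_distrib_left sum_divide_distrib)
  moreover have "(\<Sum>i = 1..n. real i * gap n b x i) / real n = b - (\<Sum>i = 1..n. x i) / real n"
    using assms(1) unfolding sum_index_gap by (simp add: diff_divide_distrib)
  ultimately show ?thesis
    unfolding m_fun_gap sum_gap[OF assms(1)] by linarith
qed

text \<open>The supremum is a linear program over the gaps, with the single constraint that the gaps
  weighted by \<open>l\<close> sum to at least \<open>b - m_fun n {..b} x l\<close>; the optimum has a single non-zero gap.\<close>

lemma b_fun_anderson:
  assumes "n \<ge> 1" and x: "x \<in> {1..n} \<rightarrow>\<^sub>E {..b}"
    and l_nonneg: "\<And>i. i \<in> {1..n} \<Longrightarrow> 0 \<le> order_stat n l i"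
    and "0 < order_stat n l n"
    and u_nonneg: "\<And>i. i \<in> {1..n} \<Longrightarrow> 0 \<le> order_stat n u i"
  shows "b_fun n {..b} (anderson_bound n {..b} l) x u = b - (b - m_fun n {..b} x l)
    * Min ((\<lambda>i. order_stat n u i / order_stat n l i) ` {i \<in> {1..n}. 0 < order_stat n l i})"
proof -
  define J where "J = {i \<in> {1..n}. 0 < order_stat n l i}"
  \<comment> \<open>The largest factor for which \<open>\<rho>\<close> times the order statistics of
    \<open>l\<close> stays below those of \<open>u\<close>; indices where \<open>l\<close> vanishes
    impose no constraint because \<open>u\<close> is nonnegative.\<close>
  define \<rho> where "\<rho> = Min ((\<lambda>i. order_stat n u i / order_stat n l i) ` J)"
  define C where "C = b - m_fun n {..b} x l"
  have "finite J" "n \<in> J"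
    using assms by (auto simp: J_def)
  have "0 \<le> C"
    unfolding C_def m_fun_gap using l_nonneg gap_nonneg[OF x] by (auto intro!: sum_nonneg)
  have "\<rho> \<in> (\<lambda>i. order_stat n u i / order_stat n l i) ` J"
    unfolding \<rho>_def using \<open>finite J\<close> \<open>n \<in> J\<close> by (intro Min_in) auto
  then obtain k where "k \<in> J" and \<rho>: "\<rho> = order_stat n u k / order_stat n l k"
    by auto
  then have k: "1 \<le> k" "k \<le> n" "0 < order_stat n l k"
    by (auto simp: J_def)
  have "0 \<le> \<rho>"
    using u_nonneg[of k] k by (simp add: \<rho>)
  have u_ge: "\<rho> * order_stat n l i \<le> order_stat n u i" if "i \<in> {1..n}" for i
  proof (cases "0 < order_stat n l i")
    case True
    then have "\<rho> \<le> order_stat n u i / order_stat n l i"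
      unfolding \<rho>_def using \<open>finite J\<close> that by (intro Min_le) (auto simp: J_def)
    then show ?thesis
      using True by (simp add: pos_le_divide_eq)
  next
    case False
    then have "order_stat n l i = 0"
      using l_nonneg[OF that] by simp
    then show ?thesis
      using u_nonneg[OF that] by simp
  qed
  \<comment> \<open>The optimum: its only gap sits at an index \<open>k\<close> attaining the
    minimum \<open>\<rho>\<close>, and its size makes \<open>m_fun n {..b} z l\<close> equal to
    \<open>m_fun n {..b} x l\<close>. The domain being unbounded below, every size is
    admissible.\<close>
  define z where "z = (\<lambda>j\<in>{1..n}. if j \<le> k then b - C / order_stat n l k else b)"
  have z_mono: "z i \<le> z j" if "1 \<le> i" "i \<le> j" "j \<le> n" for i j
    using that \<open>0 \<le> C\<close> k by (auto simp: z_def)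
  have gap_z: "gap n b z i = (if i = k then C / order_stat n l k else 0)" if i: "i \<in> {1..n}" for i
  proof -
    have "order_stat n z j = z j" if "j \<in> {1..n}" for j
      using z_mono that by (rule order_stat_eq)
    then show ?thesis
      using i k by (cases "i = n") (auto simp: gap_def z_def)
  qed
  have m_z: "m_fun n {..b} z w = b - C * (order_stat n w k / order_stat n l k)" for w
  proof -
    have "(\<Sum>i = 1..n. order_stat n w i * gap n b z i)
        = (\<Sum>i = 1..n. if i = k then order_stat n w k * (C / order_stat n l k) else 0)"
      by (intro sum.cong) (auto simp: gap_z)
    then show ?thesis
      using k by (simp add: m_fun_gap)
  qed
  have z: "z \<in> S_set n {..b} (anderson_bound n {..b} l) x"
    using \<open>0 \<le> C\<close> k by (auto simp: S_set_def anderson_bound_def m_z) (auto simp: z_def C_def)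
  have le: "m_fun n {..b} y u \<le> b - C * \<rho>"
    if "y \<in> S_set n {..b} (anderson_bound n {..b} l) x" for y
  proof -
    have y: "y \<in> {1..n} \<rightarrow>\<^sub>E {..b}" "m_fun n {..b} y l \<le> m_fun n {..b} x l"
      using that by (auto simp: S_set_def anderson_bound_def)
    have "C \<le> (\<Sum>i = 1..n. order_stat n l i * gap n b y i)"
      using y(2) unfolding C_def m_fun_gap[of n b y] by simp
    then have "\<rho> * C \<le> \<rho> * (\<Sum>i = 1..n. order_stat n l i * gap n b y i)"
      using \<open>0 \<le> \<rho>\<close> by (rule mult_left_mono)
    also have "\<dots> = (\<Sum>i = 1..n. (\<rho> * order_stat n l i) * gap n b y i)"
      by (simp add: sum_distrib_left mult.assoc)
    also have "\<dots> \<le> (\<Sum>i = 1..n. order_stat n u i * gap n b y i)"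
      using u_ge gap_nonneg[OF y(1)] by (intro sum_mono mult_right_mono) auto
    finally show ?thesis
      by (simp add: m_fun_gap mult.commute)
  qed
  have "b_fun n {..b} (anderson_bound n {..b} l) x u = b - C * \<rho>"
    unfolding b_fun_def
  proof (rule cSup_eq_maximum)
    show "b - C * \<rho> \<in> (\<lambda>z. m_fun n {..b} z u) ` S_set n {..b} (anderson_bound n {..b} l) x"
      using z m_z[of u] by (auto simp: \<rho> intro!: image_eqI[of _ _ z])
  qed (use le in auto)
  then show ?thesis
    by (simp add: C_def \<rho>_def J_def)
qed


section \<open>The quantile bound induced by the Anderson bound, and its comparison with
  Hoeffding\<close>

lemma order_stat_u_And:
  assumes "i \<in> {1..n}"
  shows "order_stat n (u_And n \<alpha>) i = max 0 (real i / real n - beta_KS n \<alpha>)"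
proof -
  have "u_And n \<alpha> j \<le> u_And n \<alpha> k" if "1 \<le> j" "j \<le> k" "k \<le> n" for j k
    using that divide_right_mono[of "real j" "real k" "real n"] by (auto simp: u_And_def)
  then have "order_stat n (u_And n \<alpha>) i = u_And n \<alpha> i"
    using assms by (rule order_stat_eq)
  then show ?thesis
    using assms by (simp add: u_And_def)
qed

text \<open>The closed form \<open>Y\<close> of the supremum supplies the measurability that the
  distribution function requires. Off the exceedance event, that is with probability
  \<open>1 - \<alpha>\<close>, every ratio in the minimum is at least \<open>1\<close>, so
  \<open>Y\<close> is at most the Anderson bound, which therefore belongs to the set whose infimum
  is the quantile.\<close>

lemma b_bound_anderson_le:
  assumes "n \<ge> 1" "0 < \<alpha>" "\<alpha> < 1" and x: "x \<in> {1..n} \<rightarrow>\<^sub>E {..b}"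
  shows "b_bound n \<alpha> {..b} (anderson_bound n {..b} (u_And n \<alpha>)) x \<le> m_fun n {..b} x (u_And n \<alpha>)"
proof -
  interpret prob_space "unif_cube n"
    by (rule prob_space_unif_cube)
  define \<beta> where "\<beta> = beta_KS n \<alpha>"
  define l where "l i = max 0 (real i / real n - \<beta>)" for i
  have l: "order_stat n (u_And n \<alpha>) i = l i" if "i \<in> {1..n}" for i
    using order_stat_u_And[OF that] by (simp add: l_def \<beta>_def)
  have "0 < l n"
    using beta_KS_less_1[OF assms(1-3)] assms(1) by (simp add: l_def \<beta>_def)
  define J where "J = {i \<in> {1..n}. 0 < l i}"
  have J: "finite J" "n \<in> J" "J \<subseteq> {1..n}"
    using assms(1) \<open>0 < l n\<close> by (auto simp: J_def)
  define A where "A = m_fun n {..b} x (u_And n \<alpha>)"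
  define C where "C = b - A"
  have "0 \<le> C"
    unfolding C_def A_def m_fun_gap using gap_nonneg[OF x] l by (auto intro!: sum_nonneg simp: l_def)
  define Y where "Y u = b - C * Min ((\<lambda>i. order_stat n u i / l i) ` J)" for u
  have nonneg: "0 \<le> order_stat n u i" and le_1: "order_stat n u i \<le> 1"
    if "u \<in> space (unif_cube n)" "i \<in> {1..n}" for u i
    using order_stat_mem[OF that(2), of u] component_unif_cube[OF that(1)] by auto
  have b_fun: "b_fun n {..b} (anderson_bound n {..b} (u_And n \<alpha>)) x u = Y u"
    if "u \<in> space (unif_cube n)" for u
  proof -
    have "{i \<in> {1..n}. 0 < order_stat n (u_And n \<alpha>) i} = J"
      using l by (auto simp: J_def)
    moreover have "(\<lambda>i. order_stat n u i / order_stat n (u_And n \<alpha>) i) ` J = (\<lambda>i. order_stat n u i / l i) ` J"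
      using l J(3) by (intro image_cong) auto
    moreover have "b_fun n {..b} (anderson_bound n {..b} (u_And n \<alpha>)) x u
        = b - (b - m_fun n {..b} x (u_And n \<alpha>))
        * Min ((\<lambda>i. order_stat n u i / order_stat n (u_And n \<alpha>) i)
            ` {i \<in> {1..n}. 0 < order_stat n (u_And n \<alpha>) i})"
      using l nonneg[OF that] \<open>0 < l n\<close> assms(1) by (intro b_fun_anderson[OF assms(1) x]) (auto simp: l_def)
    ultimately show ?thesis
      by (simp add: Y_def C_def A_def)
  qed
  have Y [measurable]: "Y \<in> borel_measurable (unif_cube n)"
  proof -
    have "(\<lambda>u. order_stat n u i / l i) \<in> borel_measurable (unif_cube n)" if "i \<in> J" for i
      using J(3) that by (intro borel_measurable_divide order_stat_measurable) auto
    then have [measurable]: "(\<lambda>u. Min ((\<lambda>i. order_stat n u i / l i) ` J)) \<in> borel_measurable (unif_cube n)"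
      by (rule borel_measurable_Min[where f = "\<lambda>i u. order_stat n u i / l i", OF J(1)])
    show ?thesis
      unfolding Y_def[abs_def] by measurable
  qed
  define Z where "Z = b_fun n {..b} (anderson_bound n {..b} (u_And n \<alpha>)) x"
  have "Z \<in> borel_measurable (unif_cube n)"
    using Y by (subst measurable_cong[where g = Y]) (simp_all add: Z_def b_fun)
  then have cdf: "cdf (distr (unif_cube n) borel Z) y = measure (unif_cube n) {u \<in> space (unif_cube n). Y u \<le> y}" for y
    unfolding cdf_def by (subst measure_distr) (auto intro!: arg_cong2[where f = measure] simp: Z_def b_fun)
  have "Y u \<le> A" if "u \<in> space (unif_cube n)" "u \<notin> exceedance n \<beta>" for u
  proof -
    have "1 \<le> order_stat n u i / l i" if "i \<in> J" for i
    proof -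
      have i: "i \<in> {1..n}" "0 < l i"
        using that by (auto simp: J_def)
      have "\<not> i \<le> count_below n u (real i / real n - \<beta>)"
        using \<open>u \<notin> exceedance n \<beta>\<close> \<open>u \<in> space (unif_cube n)\<close> i(1) by (auto simp: exceedance_def)
      then have "real i / real n - \<beta> \<le> order_stat n u i"
        using order_stat_less_iff[OF i(1)] by (metis not_le)
      then have "l i \<le> order_stat n u i"
        using i(2) by (auto simp: l_def)
      then show ?thesis
        using i(2) by simp
    qed
    then have "1 \<le> Min ((\<lambda>i. order_stat n u i / l i) ` J)"
      using J by (subst Min_ge_iff) auto
    then have "C * 1 \<le> C * Min ((\<lambda>i. order_stat n u i / l i) ` J)"
      using \<open>0 \<le> C\<close> by (rule mult_left_mono)
    then show ?thesis
      by (simp add: Y_def C_def)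
  qed
  then have "space (unif_cube n) - exceedance n \<beta> \<subseteq> {u \<in> space (unif_cube n). Y u \<le> A}"
    by auto
  then have "prob (space (unif_cube n) - exceedance n \<beta>) \<le> prob {u \<in> space (unif_cube n). Y u \<le> A}"
    by (intro finite_measure_mono) auto
  then have A: "1 - \<alpha> \<le> prob {u \<in> space (unif_cube n). Y u \<le> A}"
    using measure_exceedance_beta_KS[OF assms(1-3)] by (simp add: prob_compl \<beta>_def)
  \<comment> \<open>An infimum of reals is meaningful only for sets bounded below. The bound comes
    from the ratio at index \<open>n\<close>, where the order statistic is at most
    \<open>1\<close>.\<close>
  have "b - C * (1 / l n) \<le> y" if "1 - \<alpha> \<le> prob {u \<in> space (unif_cube n). Y u \<le> y}" for y
  proof -
    have "{u \<in> space (unif_cube n). Y u \<le> y} \<noteq> {}"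
      using that \<open>\<alpha> < 1\<close> by (intro notI) simp
    then obtain u where u: "u \<in> space (unif_cube n)" "Y u \<le> y"
      by auto
    have "Min ((\<lambda>i. order_stat n u i / l i) ` J) \<le> order_stat n u n / l n"
      using J by (intro Min_le) auto
    also have "\<dots> \<le> 1 / l n"
      using le_1[OF u(1), of n] assms(1) \<open>0 < l n\<close> by (intro divide_right_mono) auto
    finally have "C * Min ((\<lambda>i. order_stat n u i / l i) ` J) \<le> C * (1 / l n)"
      using \<open>0 \<le> C\<close> by (rule mult_left_mono)
    then show ?thesis
      using u(2) by (simp add: Y_def)
  qed
  then have "bdd_below {y. 1 - \<alpha> \<le> cdf (distr (unif_cube n) borel Z) y}"
    unfolding cdf by (intro bdd_belowI[of _ "b - C * (1 / l n)"]) auto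
  then have "Inf {y. 1 - \<alpha> \<le> cdf (distr (unif_cube n) borel Z) y} \<le> A"
    using A by (intro cInf_lower) (auto simp: cdf)
  then show ?thesis
    by (simp add: b_bound_def quantile_def Z_def A_def)
qed

theorem theorem4p4:
  fixes a b \<alpha> :: real and D :: "real set" and n :: nat and x :: "nat \<Rightarrow> real"
  assumes "a < b"
    and "D \<subseteq> {a..b}"
    and "n \<ge> 1"
    and "0 < \<alpha>" and "\<alpha> \<le> 1 / 2"
    and "x \<in> {1..n} \<rightarrow>\<^sub>E D"
  shows "b_bound n \<alpha> {..b} (anderson_bound n {..b} (u_And n \<alpha>)) x \<le> hoeffding_bound n \<alpha> a b x
    \<and> (n \<ge> 3 \<longrightarrow>
        b_bound n \<alpha> {..b} (anderson_bound n {..b} (u_And n \<alpha>)) x < hoeffding_bound n \<alpha> a b x)"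
proof -
  have "\<alpha> < 1"
    using assms by simp
  define \<beta> where "\<beta> = beta_KS n \<alpha>"
  have "D \<subseteq> {..b}"
    using assms(2) by auto
  then have x: "x \<in> {1..n} \<rightarrow>\<^sub>E {a..b}" "x \<in> {1..n} \<rightarrow>\<^sub>E {..b}"
    using assms(2,6) PiE_mono[of "{1..n}" "\<lambda>_. D" "\<lambda>_. {a..b}"]
      PiE_mono[of "{1..n}" "\<lambda>_. D" "\<lambda>_. {..b}"] by blast+
  have "b_bound n \<alpha> {..b} (anderson_bound n {..b} (u_And n \<alpha>)) x \<le> m_fun n {..b} x (u_And n \<alpha>)"
    by (rule b_bound_anderson_le[OF assms(3,4) \<open>\<alpha> < 1\<close> x(2)])
  also have "\<dots> \<le> (\<Sum>i = 1..n. x i) / real n + \<beta> * (b - a)"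
  proof (rule m_fun_le_mean)
    fix i assume "i \<in> {1..n}"
    then show "real i / real n - \<beta> \<le> order_stat n (u_And n \<alpha>) i"
      by (simp add: order_stat_u_And \<beta>_def)
  qed (use assms x beta_KS_nonneg[OF assms(3,4) \<open>\<alpha> < 1\<close>] in \<open>auto simp: \<beta>_def\<close>)
  \<comment> \<open>The strict step: \<open>\<beta>\<close> lies strictly below the factor in
    Hoeffding's deviation term, and \<open>b - a\<close> is positive.\<close>
  also have "\<dots> < (\<Sum>i = 1..n. x i) / real n + sqrt (ln (1 / \<alpha>) / (2 * real n)) * (b - a)"
    using beta_KS_less[OF assms(3,4) \<open>\<alpha> < 1\<close>] assms(1)
    by (intro add_strict_left_mono mult_strict_right_mono) (auto simp: \<beta>_def)
  also have "\<dots> = hoeffding_bound n \<alpha> a b x"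
    by (simp add: hoeffding_bound_def)
  finally show ?thesis
    by simp
qed

end
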